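(* Let $f=(f_1,f_2)$ with $0<f_1,f_2<1$, $r_j=(r^1_j,r^2_j)\in\mathbb{R}^2$, and $\bar v_1,\dots,\bar v_4,\bar w_1,\dots,\bar w_4\ge0$ satisfying $f_1\bar v_1+f_2\bar w_1=1$, $(1-f_1)\bar v_2+f_2\bar w_2=1$, $(1-f_1)\bar v_3+(1-f_2)\bar w_3=1$, $f_1\bar v_4+(1-f_2)\bar w_4=1$. Then the mixed integer program $$\begin{array}{ll}\min & \alpha_j\\ & \alpha_j-\bar v_1m^1_j-\bar w_1m^2_j\ge -r^1_j\bar v_1-r^2_j\bar w_1\\ & \alpha_j+\bar v_2m^1_j-\bar w_2m^2_j\ge r^1_j\bar v_2-r^2_j\bar w_2\\ & \alpha_j+\bar v_3m^1_j+\bar w_3m^2_j\ge r^1_j\bar v_3+r^2_j\bar w_3\\ & \alpha_j-\bar v_4m^1_j+\bar w_4m^2_j\ge -r^1_j\bar v_4+r^2_j\bar w_4\\ & m^1_j,m^2_j\in\mathbb{Z}\end{array}$$ has an optimal solution $(\bar\alpha_j,\bar m^1_j,\bar m^2_j)$ satisfying $\bar m^i_j\in\{\lfloor r^i_j\rfloor,\lceil r^i_j\rceil\}$ for $i=1,2$. *)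

theory Defs
  imports "HOL-Analysis.Analysis"
begin

(* A point (alpha, m) has a free real component and two integer components; note that alpha is
   not required to be nonnegative.  In the index type 4 the numeral 4 denotes 0, so
   v $ 1, ..., v $ 4 are four distinct components. *)

definition mip_feasible :: "real ^ 4 \<Rightarrow> real ^ 4 \<Rightarrow> real ^ 2 \<Rightarrow> (real \<times> (int ^ 2)) set" where
  "mip_feasible v w r = {(\<alpha>, m).
      \<alpha> - v $ 1 * of_int (m $ 1) - w $ 1 * of_int (m $ 2) \<ge> - (r $ 1) * v $ 1 - r $ 2 * w $ 1 \<and>
      \<alpha> + v $ 2 * of_int (m $ 1) - w $ 2 * of_int (m $ 2) \<ge> r $ 1 * v $ 2 - r $ 2 * w $ 2 \<and>
      \<alpha> + v $ 3 * of_int (m $ 1) + w $ 3 * of_int (m $ 2) \<ge> r $ 1 * v $ 3 + r $ 2 * w $ 3 \<and>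
      \<alpha> - v $ 4 * of_int (m $ 1) + w $ 4 * of_int (m $ 2) \<ge> - (r $ 1) * v $ 4 + r $ 2 * w $ 4}"

definition mip_optimal_solution ::
    "real ^ 4 \<Rightarrow> real ^ 4 \<Rightarrow> real ^ 2 \<Rightarrow> real \<times> (int ^ 2) \<Rightarrow> bool" where
  "mip_optimal_solution v w r x \<longleftrightarrow>
     x \<in> mip_feasible v w r \<and> (\<forall>y \<in> mip_feasible v w r. fst x \<le> fst y)"

end

theory Submission
  imports Defs
begin

text \<open>
  Put \<open>d = m - r\<close>. The least feasible \<open>\<alpha>\<close> for a given \<open>m\<close> is the maximum \<open>g d\<close> of four linear forms
  \<open>n\<^sub>k \<bullet> d\<close>, where \<open>n\<^sub>k\<close> lies in the \<open>k\<close>-th quadrant and takes the value 1 at the \<open>k\<close>-th corner of the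
  unit square \<open>[f\<^sub>1 - 1, f\<^sub>1] \<times> [f\<^sub>2 - 1, f\<^sub>2]\<close>. Rounding each \<open>r\<^sup>i\<close> up or down according to whether
  \<open>\<lceil>r\<^sup>i\<rceil> - r\<^sup>i\<close> is below \<open>f\<^sub>i\<close> gives \<open>g \<le> 1\<close>. If an integer point \<open>m\<close> has \<open>g d < 1\<close>, then rounding \<open>r\<close>
  towards \<open>m\<close> does not increase \<open>g\<close>. So every \<open>m\<close> is dominated by one of the at most four roundings
  of \<open>r\<close>, and the best of these is optimal.
\<close>

text \<open>The normals are \<open>(p, q)\<close> in the first quadrant and
  \<open>(p', - q')\<close> in the fourth. If \<open>y = b\<close>, monotonicity in \<open>x\<close>
  suffices. Otherwise the unit gap in \<open>y\<close> gives \<open>p * a + q \<le> t\<close>, and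
  this dominates \<open>p' * a\<close>.\<close>

lemma adjacent_form_le:
  fixes F G p q p' q' a b x y t :: real
  assumes F: "0 < F" and G: "0 < G" "G < 1"
    and nn: "0 \<le> p" "0 \<le> q" "0 \<le> p'" "0 \<le> q'"
    and eq: "F * p + G * q = 1" "F * p' + (1 - G) * q' = 1"
    and ab: "0 \<le> a" "0 \<le> b" "a \<le> x" "y = b \<or> b + 1 \<le> y"
    and t: "t < 1" "p * x + q * y \<le> t" "p' * x - q' * y \<le> t"
  shows "p' * a - q' * b \<le> t"
proof (cases "y = b")
  case True
  have "p' * a \<le> p' * x" using nn ab by (intro mult_left_mono)
  then show ?thesis using t True by simp
next
  case False
  then have y: "b + 1 \<le> y" using ab by simp
  have px: "p * a \<le> p * x" using nn ab by (intro mult_left_mono)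
  have qy: "q * 1 \<le> q * y" using nn ab y by (intro mult_left_mono) auto
  have Gq: "G * q \<le> 1 * q" using G nn by (intro mult_right_mono) auto
  \<comment> \<open>If \<open>a > F\<close>, then \<open>x > F\<close> and
    \<open>y \<ge> 1 > G\<close>, so the first form would reach its value 1 at the corner
    \<open>(F, G)\<close>.\<close>
  have aF: "a \<le> F"
  proof (rule ccontr)
    assume "\<not> a \<le> F"
    then have "p * F \<le> p * a" using nn by (intro mult_left_mono) auto
    then have "1 \<le> p * x + q * y" using px qy Gq eq(1) by (simp add: mult.commute)
    then show False using t by simp
  qed
  have "0 \<le> (1 - G) * q'" using G nn by simp
  \<comment> \<open>Both normalizations enter here: \<open>F * p' \<le> 1 = F * p + G * q\<close>.
    Next, scaling by \<open>a\<close> and using \<open>a \<le> F\<close> on the term in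
    \<open>q\<close> allows \<open>F\<close> to be cancelled.\<close>
  then have "F * p' \<le> F * p + q" using eq Gq by linarith
  then have "a * (F * p') \<le> a * (F * p + q)" using ab by (intro mult_left_mono)
  also have "\<dots> \<le> F * (a * p + q)"
    using mult_right_mono[OF aF nn(2)] by (simp add: algebra_simps)
  finally have "F * (a * p') \<le> F * (a * p + q)" by (simp add: algebra_simps)
  then have "a * p' \<le> a * p + q" using F by simp
  moreover have "0 \<le> q' * b" using nn ab by simp
  ultimately show ?thesis using px qy t by (simp add: mult.commute)
qed

text \<open>
  The Booleans \<open>\<sigma>\<close>, \<open>\<tau>\<close> are the signs of the two entries of a normal vector, so that a reflection of a
  coordinate negates an argument of \<open>p\<close> and \<open>q\<close>.
\<close>

definition below :: "(bool \<Rightarrow> bool \<Rightarrow> real) \<Rightarrow> (bool \<Rightarrow> bool \<Rightarrow> real) \<Rightarrow> real \<Rightarrow> real \<Rightarrow> real \<Rightarrow> bool" where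
  "below p q t x y \<longleftrightarrow>
     (\<forall>\<sigma> \<tau>. (if \<sigma> then 1 else - 1) * (p \<sigma> \<tau> * x) + (if \<tau> then 1 else - 1) * (q \<sigma> \<tau> * y) \<le> t)"

text \<open>Each equation evaluates a signed form at the corner of the square with the same signs; a
  negative entry meets \<open>F - 1\<close> or \<open>G - 1\<close>, so the signs cancel.\<close>

definition normalized :: "real \<Rightarrow> real \<Rightarrow> (bool \<Rightarrow> bool \<Rightarrow> real) \<Rightarrow> (bool \<Rightarrow> bool \<Rightarrow> real) \<Rightarrow> bool" where
  "normalized F G p q \<longleftrightarrow> 0 < F \<and> F < 1 \<and> 0 < G \<and> G < 1 \<and>
     (\<forall>\<sigma> \<tau>. 0 \<le> p \<sigma> \<tau> \<and> 0 \<le> q \<sigma> \<tau> \<and>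
        (if \<sigma> then F else 1 - F) * p \<sigma> \<tau> + (if \<tau> then G else 1 - G) * q \<sigma> \<tau> = 1)"

lemma below_reflect_fst: "below (\<lambda>\<sigma>. p (\<not> \<sigma>)) (\<lambda>\<sigma>. q (\<not> \<sigma>)) t (- x) y \<longleftrightarrow> below p q t x y"
  unfolding below_def by (auto simp: all_bool_eq)

lemma below_reflect_snd:
  "below (\<lambda>\<sigma> \<tau>. p \<sigma> (\<not> \<tau>)) (\<lambda>\<sigma> \<tau>. q \<sigma> (\<not> \<tau>)) t x (- y) \<longleftrightarrow> below p q t x y"
  unfolding below_def by (auto simp: all_bool_eq)

lemma normalized_reflect_fst:
  "normalized F G p q \<Longrightarrow> normalized (1 - F) G (\<lambda>\<sigma>. p (\<not> \<sigma>)) (\<lambda>\<sigma>. q (\<not> \<sigma>))"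
  unfolding normalized_def by (auto simp: all_bool_eq)

lemma normalized_reflect_snd:
  "normalized F G p q \<Longrightarrow> normalized F (1 - G) (\<lambda>\<sigma> \<tau>. p \<sigma> (\<not> \<tau>)) (\<lambda>\<sigma> \<tau>. q \<sigma> (\<not> \<tau>))"
  unfolding normalized_def by (auto simp: all_bool_eq)

text \<open>The first-quadrant form is monotone. The two adjacent forms follow from
  \<open>adjacent_form_le\<close>, once with the coordinates exchanged. The opposite form is at most
  0, hence at most the first-quadrant form.\<close>

lemma below_quadrant_corner:
  assumes n: "normalized F G p q"
    and ab: "0 \<le> a" "0 \<le> b" "x = a \<or> a + 1 \<le> x" "y = b \<or> b + 1 \<le> y"
    and t: "t < 1" "below p q t x y"
  shows "below p q t a b"
proof -
  have FG: "0 < F" "F < 1" "0 < G" "G < 1" using n by (auto simp: normalized_def)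
  have nn: "0 \<le> p \<sigma> \<tau>" "0 \<le> q \<sigma> \<tau>" for \<sigma> \<tau> using n by (auto simp: normalized_def)
  have eq: "F * p True True + G * q True True = 1" "(1 - F) * p False True + G * q False True = 1"
    "F * p True False + (1 - G) * q True False = 1"
    using n by (auto simp: normalized_def all_bool_eq)
  have le: "p True True * x + q True True * y \<le> t" "q False True * y - p False True * x \<le> t"
    "p True False * x - q True False * y \<le> t"
    using t(2) by (auto simp: below_def all_bool_eq)
  have "p True True * a \<le> p True True * x" "q True True * b \<le> q True True * y"
    using nn ab by (intro mult_left_mono; auto)+
  then have 1: "p True True * a + q True True * b \<le> t" using le by simp
  have 2: "p True False * a - q True False * b \<le> t"
    using ab by (intro adjacent_form_le[OF FG(1,3,4) nn nn eq(1,3) ab(1,2) _ ab(4) t(1) le(1,3)]) auto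
  have 3: "q False True * b - p False True * a \<le> t"
    using ab le eq
    by (intro adjacent_form_le[OF FG(3,1,2) nn(2,1) nn(2,1) _ _ ab(2,1) _ ab(3) t(1)])
      (auto simp: add.commute)
  have "0 \<le> p \<sigma> \<tau> * a" "0 \<le> q \<sigma> \<tau> * b" for \<sigma> \<tau> using nn ab by simp_all
  then have "- (p False False * a) - q False False * b \<le> p True True * a + q True True * b"
    by (smt (verit))
  with 1 2 3 show ?thesis by (simp add: below_def all_bool_eq)
qed

text \<open>Each form is bounded one coordinate at a time by the matching term of its normalization:
  a positive entry uses \<open>a \<le> F\<close> or \<open>b \<le> G\<close>, a negative one
  contributes at most 0.\<close>

lemma below_one:
  assumes n: "normalized F G p q" and ab: "0 \<le> a" "a \<le> F" "0 \<le> b" "b \<le> G"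
  shows "below p q 1 a b"
proof -
  have nn: "0 \<le> p \<sigma> \<tau>" "0 \<le> q \<sigma> \<tau>" for \<sigma> \<tau> using n by (auto simp: normalized_def)
  have m: "p \<sigma> \<tau> * a \<le> F * p \<sigma> \<tau>" "q \<sigma> \<tau> * b \<le> G * q \<sigma> \<tau>" for \<sigma> \<tau>
    using mult_left_mono[OF ab(2) nn(1)] mult_left_mono[OF ab(4) nn(2)]
    by (simp_all add: mult.commute[of F] mult.commute[of G])
  have z: "0 \<le> p \<sigma> \<tau> * a" "0 \<le> q \<sigma> \<tau> * b" "0 \<le> (1 - F) * p \<sigma> \<tau>" "0 \<le> (1 - G) * q \<sigma> \<tau>" for \<sigma> \<tau>
    using nn ab n by (simp_all add: normalized_def)
  show ?thesis
    unfolding below_def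
  proof (intro allI)
    fix \<sigma> \<tau>
    have "(if \<sigma> then 1 else - 1) * (p \<sigma> \<tau> * a) \<le> (if \<sigma> then F else 1 - F) * p \<sigma> \<tau>"
    proof (cases \<sigma>)
      case False
      then show ?thesis using z(1,3)[of \<sigma> \<tau>] by simp
    qed (use m in simp)
    moreover have "(if \<tau> then 1 else - 1) * (q \<sigma> \<tau> * b) \<le> (if \<tau> then G else 1 - G) * q \<sigma> \<tau>"
    proof (cases \<tau>)
      case False
      then show ?thesis using z(2,4)[of \<sigma> \<tau>] by simp
    qed (use m in simp)
    moreover have "(if \<sigma> then F else 1 - F) * p \<sigma> \<tau> + (if \<tau> then G else 1 - G) * q \<sigma> \<tau> = 1"
      using n by (simp add: normalized_def)
    ultimately show "(if \<sigma> then 1 else - 1) * (p \<sigma> \<tau> * a) + (if \<tau> then 1 else - 1) * (q \<sigma> \<tau> * b) \<le> 1"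
      by linarith
  qed
qed

definition roundings :: "real ^ 2 \<Rightarrow> (int ^ 2) set" where
  "roundings r = {m. \<forall>i. m $ i \<in> {\<lfloor>r $ i\<rfloor>, \<lceil>r $ i\<rceil>}}"

lemma finite_roundings: "finite (roundings r)"
proof (rule finite_subset)
  show "roundings r \<subseteq> (\<lambda>(a, b). \<chi> i. if i = 1 then a else b) `
      ({\<lfloor>r $ 1\<rfloor>, \<lceil>r $ 1\<rceil>} \<times> {\<lfloor>r $ 2\<rfloor>, \<lceil>r $ 2\<rceil>})"
  proof
    fix m assume "m \<in> roundings r"
    then show "m \<in> (\<lambda>(a, b). \<chi> i. if i = 1 then a else b) `
        ({\<lfloor>r $ 1\<rfloor>, \<lceil>r $ 1\<rceil>} \<times> {\<lfloor>r $ 2\<rfloor>, \<lceil>r $ 2\<rceil>})"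
      unfolding roundings_def forall_2
      by (intro image_eqI[of _ _ "(m $ 1, m $ 2)"]) (auto simp: vec_eq_iff forall_2)
  qed
qed simp

text \<open>Here \<open>x\<close> and \<open>a\<close> stand for offsets of two integers from the
  same real, which differ by an integer: on the way from 0 to \<open>x\<close>, the point
  \<open>a\<close> is either \<open>x\<close> itself or at least 1 short of it.\<close>

definition towards :: "real \<Rightarrow> real \<Rightarrow> bool" where
  "towards x a \<longleftrightarrow> (0 \<le> a \<and> (x = a \<or> a + 1 \<le> x)) \<or> (a \<le> 0 \<and> (x = a \<or> x \<le> a - 1))"

lemma below_towards:
  assumes n: "normalized F G p q" and x: "towards x a" and y: "towards y b"
    and t: "t < 1" "below p q t x y"
  shows "below p q t a b"
proof -
  \<comment> \<open>Reflecting the first coordinate reduces to the first quadrant. Generality in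
    \<open>G\<close>, \<open>p\<close>, \<open>q\<close>, \<open>y\<close>, \<open>b\<close> permits
    reuse after the second coordinate is reflected.\<close>
  have nonneg_b: "below p q t a b"
    if n: "normalized F G p q" and b: "0 \<le> b" "y = b \<or> b + 1 \<le> y" and le: "below p q t x y"
    for G p q y b
  proof (cases "0 \<le> a \<and> (x = a \<or> a + 1 \<le> x)")
    case True
    then show ?thesis using below_quadrant_corner[OF n _ b(1) _ b(2) t(1) le] by blast
  next
    case False
    then have "0 \<le> - a" "- x = - a \<or> - a + 1 \<le> - x" using x by (auto simp: towards_def)
    from below_quadrant_corner[OF normalized_reflect_fst[OF n] this(1) b(1) this(2) b(2) t(1)]
    show ?thesis using le unfolding below_reflect_fst by blast
  qed
  show ?thesis
  proof (cases "0 \<le> b \<and> (y = b \<or> b + 1 \<le> y)")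
    case True
    then show ?thesis using nonneg_b[OF n _ _ t(2)] by blast
  next
    case False
    then have "0 \<le> - b" "- y = - b \<or> - b + 1 \<le> - y" using y by (auto simp: towards_def)
    from nonneg_b[OF normalized_reflect_snd[OF n] this] show ?thesis
      using t(2) unfolding below_reflect_snd by blast
  qed
qed

text \<open>The same two reflections carry \<open>below_one\<close> from the first-quadrant part of
  the square to the other three parts.\<close>

lemma below_one_square:
  assumes n: "normalized F G p q" and a: "F - 1 \<le> a" "a \<le> F" and b: "G - 1 \<le> b" "b \<le> G"
  shows "below p q 1 a b"
proof -
  have nonneg_b: "below p q 1 a b" if n: "normalized F G p q" and b: "0 \<le> b" "b \<le> G" for G p q b
  proof (cases "0 \<le> a")
    case True
    then show ?thesis using below_one[OF n _ a(2) b] by blast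
  next
    case False
    then have "0 \<le> - a" "- a \<le> 1 - F" using a by auto
    from below_one[OF normalized_reflect_fst[OF n] this b] show ?thesis
      unfolding below_reflect_fst .
  qed
  show ?thesis
  proof (cases "0 \<le> b")
    case True
    then show ?thesis using nonneg_b[OF n _ b(2)] by blast
  next
    case False
    then have "0 \<le> - b" "- b \<le> 1 - G" using b by auto
    from nonneg_b[OF normalized_reflect_snd[OF n] this] show ?thesis
      unfolding below_reflect_snd .
  qed
qed

lemma round_towards:
  "\<exists>c \<in> {\<lfloor>s\<rfloor>, \<lceil>s\<rceil>}. towards (of_int k - s) (of_int c - s)"
proof (cases "\<lceil>s\<rceil> \<le> k")
  case True
  then have "k = \<lceil>s\<rceil> \<or> \<lceil>s\<rceil> + 1 \<le> k" by linarith
  then have "towards (of_int k - s) (of_int \<lceil>s\<rceil> - s)" unfolding towards_def by linarith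
  then show ?thesis by blast
next
  case False
  \<comment> \<open>An integer below the ceiling of \<open>s\<close> is less than \<open>s\<close>,
    hence at most its floor.\<close>
  then have "k = \<lfloor>s\<rfloor> \<or> k \<le> \<lfloor>s\<rfloor> - 1" by linarith
  then have "towards (of_int k - s) (of_int \<lfloor>s\<rfloor> - s)" unfolding towards_def by linarith
  then show ?thesis by blast
qed

lemma round_unit:
  fixes s F :: real
  assumes "0 < F" "F < 1"
  shows "\<exists>c \<in> {\<lfloor>s\<rfloor>, \<lceil>s\<rceil>}. F - 1 \<le> of_int c - s \<and> of_int c - s \<le> F"
proof (cases "of_int \<lceil>s\<rceil> - s \<le> F")
  case True
  then have "F - 1 \<le> of_int \<lceil>s\<rceil> - s" using assms by linarith
  with True show ?thesis by blast
next
  case False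
  \<comment> \<open>The ceiling exceeds \<open>s\<close> by more than \<open>F > 0\<close>, so the
    floor is exactly 1 lower, at an offset above \<open>F - 1\<close>.\<close>
  then have "F - 1 \<le> of_int \<lfloor>s\<rfloor> - s \<and> of_int \<lfloor>s\<rfloor> - s \<le> F"
    using assms ceiling_diff_floor_le_1[of s] of_int_floor_le[of s] by linarith
  then show ?thesis by blast
qed

text \<open>The constraints are numbered counterclockwise by the quadrant of their normal
  vector.\<close>

definition by_sign :: "real ^ 4 \<Rightarrow> bool \<Rightarrow> bool \<Rightarrow> real" where
  "by_sign v \<sigma> \<tau> = (if \<tau> then if \<sigma> then v $ 1 else v $ 2 else if \<sigma> then v $ 4 else v $ 3)"

lemma mip_feasible_iff_below:
  "(\<alpha>, m) \<in> mip_feasible v w r \<longleftrightarrow>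
     below (by_sign v) (by_sign w) \<alpha> (of_int (m $ 1) - r $ 1) (of_int (m $ 2) - r $ 2)"
  unfolding mip_feasible_def below_def by_sign_def by (auto simp: all_bool_eq algebra_simps)

lemma below_mono: "below p q t x y \<Longrightarrow> t \<le> t' \<Longrightarrow> below p q t' x y"
  unfolding below_def by (meson order_trans)

lemma ex_least_below: "\<exists>t. below p q t x y \<and> (\<forall>t'. below p q t' x y \<longrightarrow> t \<le> t')"
proof -
  let ?h = "\<lambda>(\<sigma>, \<tau>). (if \<sigma> then 1 else - 1) * (p \<sigma> \<tau> * x) + (if \<tau> then 1 else - 1) * (q \<sigma> \<tau> * y)"
  have "below p q t x y \<longleftrightarrow> Max (range ?h) \<le> t" for t
    by (subst Max_le_iff) (auto simp: below_def)
  then show ?thesis by blast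
qed

lemma rounding_dominates:
  assumes n: "normalized (f $ 1) (f $ 2) (by_sign v) (by_sign w)" and m: "(t, m) \<in> mip_feasible v w r"
  shows "\<exists>c \<in> roundings r. (t, c) \<in> mip_feasible v w r"
proof -
  obtain c d where "c \<in> {\<lfloor>r $ 1\<rfloor>, \<lceil>r $ 1\<rceil>}" "d \<in> {\<lfloor>r $ 2\<rfloor>, \<lceil>r $ 2\<rceil>}"
    "below (by_sign v) (by_sign w) t (of_int c - r $ 1) (of_int d - r $ 2)"
  proof (cases "t < 1")
    case True
    obtain c d where cd: "c \<in> {\<lfloor>r $ 1\<rfloor>, \<lceil>r $ 1\<rceil>}" "d \<in> {\<lfloor>r $ 2\<rfloor>, \<lceil>r $ 2\<rceil>}"
      "towards (of_int (m $ 1) - r $ 1) (of_int c - r $ 1)"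
      "towards (of_int (m $ 2) - r $ 2) (of_int d - r $ 2)"
      using round_towards by metis
    show ?thesis
      using that[OF cd(1,2) below_towards[OF n cd(3,4) True]] m
      unfolding mip_feasible_iff_below by blast
  next
    \<comment> \<open>For \<open>t \<ge> 1\<close> the choice ignores \<open>m\<close>: any rounding
      with offset in the unit square has all forms at most 1.\<close>
    case False
    have f: "0 < f $ 1" "f $ 1 < 1" "0 < f $ 2" "f $ 2 < 1" using n by (auto simp: normalized_def)
    obtain c d where cd: "c \<in> {\<lfloor>r $ 1\<rfloor>, \<lceil>r $ 1\<rceil>}" "d \<in> {\<lfloor>r $ 2\<rfloor>, \<lceil>r $ 2\<rceil>}"
      "f $ 1 - 1 \<le> of_int c - r $ 1" "of_int c - r $ 1 \<le> f $ 1"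
      "f $ 2 - 1 \<le> of_int d - r $ 2" "of_int d - r $ 2 \<le> f $ 2"
      using round_unit[OF f(1,2)] round_unit[OF f(3,4)] by metis
    show ?thesis
      using that[OF cd(1,2) below_mono[OF below_one_square[OF n cd(3-6)]]] False by simp
  qed
  then show ?thesis
    by (intro bexI[of _ "vector [c, d]"])
      (simp_all add: mip_feasible_iff_below roundings_def forall_2 vector_2)
qed

theorem theorem6p3:
  fixes f r :: "real ^ 2" and v w :: "real ^ 4"
  assumes f_bounds: "0 < f $ 1" "f $ 1 < 1" "0 < f $ 2" "f $ 2 < 1"
    and nonneg: "\<forall>k. 0 \<le> v $ k" "\<forall>k. 0 \<le> w $ k"
    and "f $ 1 * v $ 1 + f $ 2 * w $ 1 = 1"
    and "(1 - f $ 1) * v $ 2 + f $ 2 * w $ 2 = 1"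
    and "(1 - f $ 1) * v $ 3 + (1 - f $ 2) * w $ 3 = 1"
    and "f $ 1 * v $ 4 + (1 - f $ 2) * w $ 4 = 1"
  shows "\<exists>\<alpha> m. mip_optimal_solution v w r (\<alpha>, m) \<and>
           (\<forall>i. m $ i \<in> {\<lfloor>r $ i\<rfloor>, \<lceil>r $ i\<rceil>})"
proof -
  have "normalized (f $ 1) (f $ 2) (by_sign v) (by_sign w)"
    using assms unfolding normalized_def by_sign_def by (auto simp: all_bool_eq)
  note dominates = rounding_dominates[OF this]
  \<comment> \<open>\<open>g m\<close> is the least feasible objective value over \<open>m\<close>;
    it exists by \<open>ex_least_below\<close>.\<close>
  define g where "g m = (SOME \<alpha>. (\<alpha>, m) \<in> mip_feasible v w r \<and>
    (\<forall>\<beta>. (\<beta>, m) \<in> mip_feasible v w r \<longrightarrow> \<alpha> \<le> \<beta>))" for m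
  have g: "(g m, m) \<in> mip_feasible v w r \<and> (\<forall>\<beta>. (\<beta>, m) \<in> mip_feasible v w r \<longrightarrow> g m \<le> \<beta>)" for m
    unfolding g_def mip_feasible_iff_below by (rule someI_ex) (rule ex_least_below)
  have "roundings r \<noteq> {}" using dominates g by blast
  then obtain c where c: "c \<in> roundings r" and min: "\<And>d. d \<in> roundings r \<Longrightarrow> g c \<le> g d"
    using ex_min_if_finite[of "g ` roundings r"] finite_roundings
    by (metis (no_types, lifting) arg_min_if_finite(1) arg_min_least)
  \<comment> \<open>Some rounding \<open>d\<close> is feasible at the same level \<open>t\<close>,
    so \<open>g c \<le> g d \<le> t\<close>.\<close>
  have "g c \<le> t" if "(t, m) \<in> mip_feasible v w r" for t m
    using dominates[OF that] g min by (meson order_trans)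
  then have "mip_optimal_solution v w r (g c, c)"
    using g by (auto simp: mip_optimal_solution_def)
  then show ?thesis using c unfolding roundings_def by blast
qed

end
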